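(* Let $H$ be a complex Hilbert space and $T\in\mathcal{B}(H)$. Then $$\sigma_{SBF_+^-}(T)\cup \mathcal{S}(T)=\sigma_{lD}(T).$$
   Context: $\mathcal{B}(H)$ is the algebra of bounded linear operators on $H$; $N(T)$ and $R(T)$ denote null space and range. An operator is upper semi-Fredholm if its range is closed and its null space is finite-dimensional; its index is $\dim N-\operatorname{codim} R$ (possibly $-\infty$). For an integer $n\ge 0$, $T_{[n]}$ is the restriction of $T$ to $R(T^n)$, viewed as a map $R(T^n)\to R(T^n)$. $T$ is upper semi-B-Fredholm if for some $n\ge0$ the space $R(T^n)$ is closed and $T_{[n]}$ is upper semi-Fredholm; then $\mathrm{ind}(T)$ is defined as the index of $T_{[n]}$ (independent of such $n$). $SBF_+^-$ is the class of upper semi-B-Fredholm operators with $\mathrm{ind}(T)\le 0$, and $\sigma_{SBF_+^-}(T)=\{\lambda\in\mathbb{C}: T-\lambda I\notin SBF_+^-\}$. The ascent is $a(T)=\inf\{n\ge0: N(T^n)=N(T^{n+1})\}$ ($\inf\emptyset=\infty$). $T$ is left Drazin invertible if $a(T)<\infty$ and $R(T^{a(T)+1})$ is closed; $\sigma_{lD}(T)=\{\lambda\in\mathbb{C}: T-\lambda I\text{ is not left Drazin invertible}\}$. $T$ has the single-valued extension property (SVEP) at $\lambda_0\in\mathbb{C}$ if for every open disc $D$ centered at $\lambda_0$ the only analytic $f:D\to H$ with $(T-\lambda)f(\lambda)=0$ for all $\lambda\in D$ is $f\equiv0$. $\mathcal{S}(T)$ is the set of $\lambda\in\mathbb{C}$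 at which $T$ does not have SVEP. *)

theory Defs
  imports "HOL-Analysis.Analysis"
begin

(* Complex Hilbert spaces. The norm and topology come from banach; the axioms tie them to the
   sesquilinear form, and positive definiteness is contained in cinner_self. *)
class complex_hilbert_space = banach +
  fixes scaleC :: "complex \<Rightarrow> 'a \<Rightarrow> 'a" (infixr "*\<^sub>C" 75)
    and cinner :: "'a \<Rightarrow> 'a \<Rightarrow> complex"
  assumes scaleC_add_right: "c *\<^sub>C (x + y) = c *\<^sub>C x + c *\<^sub>C y"
    and scaleC_add_left: "(c + d) *\<^sub>C x = c *\<^sub>C x + d *\<^sub>C x"
    and scaleC_scaleC: "c *\<^sub>C d *\<^sub>C x = (c * d) *\<^sub>C x"
    and scaleC_of_real: "complex_of_real r *\<^sub>C x = r *\<^sub>R x"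
    and cinner_commute: "cinner x y = cnj (cinner y x)"
    and cinner_add_left: "cinner (x + y) z = cinner x z + cinner y z"
    and cinner_scaleC_left: "cinner (c *\<^sub>C x) y = c * cinner x y"
    and cinner_self: "cinner x x = complex_of_real ((norm x)\<^sup>2)"

instantiation complex :: complex_hilbert_space
begin

definition scaleC_complex :: "complex \<Rightarrow> complex \<Rightarrow> complex"
  where "scaleC_complex c x = c * x"

definition cinner_complex :: "complex \<Rightarrow> complex \<Rightarrow> complex"
  where "cinner_complex x y = x * cnj y"

instance
  by standard
    (simp_all add: scaleC_complex_def cinner_complex_def algebra_simps scaleR_conv_of_real
      complex_norm_square[symmetric])

end

lemma scaleC_one: "1 *\<^sub>C x = (x :: 'a :: complex_hilbert_space)"
  using scaleC_of_real[of 1 x] by simp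

global_interpretation complex_vector:
  vector_space "scaleC :: complex \<Rightarrow> 'a \<Rightarrow> 'a :: complex_hilbert_space"
  by unfold_locales (simp_all add: scaleC_add_right scaleC_add_left scaleC_scaleC scaleC_one)

definition bounded_clinear :: "('a :: complex_hilbert_space \<Rightarrow> 'a) \<Rightarrow> bool"
  where "bounded_clinear T \<longleftrightarrow> bounded_linear T \<and> (\<forall>c x. T (c *\<^sub>C x) = c *\<^sub>C T x)"

definition shift :: "('a :: complex_hilbert_space \<Rightarrow> 'a) \<Rightarrow> complex \<Rightarrow> 'a \<Rightarrow> 'a"
  where "shift T \<mu> = (\<lambda>x. T x - \<mu> *\<^sub>C x)"

definition null_space :: "('a \<Rightarrow> 'a :: zero) \<Rightarrow> 'a set"
  where "null_space T = {x. T x = 0}"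

definition finite_cdim :: "'a :: complex_hilbert_space set \<Rightarrow> bool"
  where "finite_cdim V \<longleftrightarrow> (\<exists>B. finite B \<and> V \<subseteq> complex_vector.span B)"

(* dim (M / R) for subspaces R of M: the least size of a finite set whose cosets span M / R,
   and \<infinity> if there is no such set. *)
definition ccodim :: "'a :: complex_hilbert_space set \<Rightarrow> 'a set \<Rightarrow> enat"
  where "ccodim M R =
    (INF B \<in> {B. finite B \<and> B \<subseteq> M \<and> M \<subseteq> complex_vector.span (R \<union> B)}. enat (card B))"

(* The next two notions concern the operator M \<rightarrow> M obtained by restricting T to a T-invariant
   subspace M: its null space is null_space T \<inter> M, its range is T ` M, and closedness and
   codimension of the range are relative to M. *)
definition upper_semi_Fredholm_on ::
    "'a :: complex_hilbert_space set \<Rightarrow> ('a \<Rightarrow> 'a) \<Rightarrow> bool"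
  where "upper_semi_Fredholm_on M T \<longleftrightarrow>
    closedin (top_of_set M) (T ` M) \<and> finite_cdim (null_space T \<inter> M)"

(* Only meaningful when the null space is finite-dimensional, since complex_vector.dim is 0 on
   infinite-dimensional spaces. *)
definition Fredholm_index_on :: "'a :: complex_hilbert_space set \<Rightarrow> ('a \<Rightarrow> 'a) \<Rightarrow> ereal"
  where "Fredholm_index_on M T =
    ereal (real (complex_vector.dim (null_space T \<inter> M))) - ereal_of_enat (ccodim M (T ` M))"

definition upper_semi_B_Fredholm_at :: "('a :: complex_hilbert_space \<Rightarrow> 'a) \<Rightarrow> nat \<Rightarrow> bool"
  where "upper_semi_B_Fredholm_at T n \<longleftrightarrow>
    closed (range (T ^^ n)) \<and> upper_semi_Fredholm_on (range (T ^^ n)) T"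

definition upper_semi_B_Fredholm :: "('a :: complex_hilbert_space \<Rightarrow> 'a) \<Rightarrow> bool"
  where "upper_semi_B_Fredholm T \<longleftrightarrow> (\<exists>n. upper_semi_B_Fredholm_at T n)"

(* The index does not depend on which admissible n is used; the least one is taken. *)
definition B_Fredholm_index :: "('a :: complex_hilbert_space \<Rightarrow> 'a) \<Rightarrow> ereal"
  where "B_Fredholm_index T =
    Fredholm_index_on (range (T ^^ (LEAST n. upper_semi_B_Fredholm_at T n))) T"

definition SBF_plus_minus :: "('a :: complex_hilbert_space \<Rightarrow> 'a) set"
  where "SBF_plus_minus =
    {T. bounded_clinear T \<and> upper_semi_B_Fredholm T \<and> B_Fredholm_index T \<le> 0}"

definition SBF_plus_minus_spectrum :: "('a :: complex_hilbert_space \<Rightarrow> 'a) \<Rightarrow> complex set"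
  where "SBF_plus_minus_spectrum T = {\<mu>. shift T \<mu> \<notin> SBF_plus_minus}"

definition ascent :: "('a :: complex_hilbert_space \<Rightarrow> 'a) \<Rightarrow> enat"
  where "ascent T = (INF n \<in> {n. null_space (T ^^ n) = null_space (T ^^ (n + 1))}. enat n)"

definition left_Drazin_invertible :: "('a :: complex_hilbert_space \<Rightarrow> 'a) \<Rightarrow> bool"
  where "left_Drazin_invertible T \<longleftrightarrow>
    ascent T < \<infinity> \<and> closed (range (T ^^ (the_enat (ascent T) + 1)))"

definition left_Drazin_spectrum :: "('a :: complex_hilbert_space \<Rightarrow> 'a) \<Rightarrow> complex set"
  where "left_Drazin_spectrum T = {\<mu>. \<not> left_Drazin_invertible (shift T \<mu>)}"

(* The library's analytic_on only covers functions into a normed field. As there, analyticity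
   on an open set is complex differentiability at each of its points. *)
definition vector_analytic_on ::
    "(complex \<Rightarrow> 'a :: complex_hilbert_space) \<Rightarrow> complex set \<Rightarrow> bool"
  where "vector_analytic_on f D \<longleftrightarrow>
    (\<forall>z\<in>D. \<exists>d. (f has_derivative (\<lambda>h. h *\<^sub>C d)) (at z))"

definition SVEP_at :: "('a :: complex_hilbert_space \<Rightarrow> 'a) \<Rightarrow> complex \<Rightarrow> bool"
  where "SVEP_at T \<mu>\<^sub>0 \<longleftrightarrow>
    (\<forall>r>0. \<forall>f. vector_analytic_on f (ball \<mu>\<^sub>0 r) \<and> (\<forall>\<mu>\<in>ball \<mu>\<^sub>0 r. shift T \<mu> (f \<mu>) = 0)
      \<longrightarrow> (\<forall>\<mu>\<in>ball \<mu>\<^sub>0 r. f \<mu> = 0))"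

definition SVEP_failure_set :: "('a :: complex_hilbert_space \<Rightarrow> 'a) \<Rightarrow> complex set"
  where "SVEP_failure_set T = {\<mu>. \<not> SVEP_at T \<mu>}"

end

theory Submission
  imports Defs "HOL-Complex_Analysis.Conformal_Mappings"
begin

text \<open>
  Write \<open>S = T - \<mu>\<close>. The operator \<open>S\<close> is left Drazin invertible iff for some \<open>p\<close> the ascent of \<open>S\<close>
  is at most \<open>p\<close> and the ranges of \<open>S\<^sup>p\<close> and \<open>S\<^sup>p\<^sup>+\<^sup>1\<close> are closed; closedness descends from a power
  to the one before it as long as the kernels have stabilised, by the open mapping theorem.

  In that case \<open>S\<close> is injective on \<open>R(S\<^sup>p)\<close> and bounded below there. An analytic \<open>f\<close> with
  \<open>(T - \<lambda>) f(\<lambda>) = 0\<close> has \<open>f(\<lambda>) = (\<lambda> - \<mu>)\<^sup>-\<^sup>p S\<^sup>p f(\<lambda>)\<close> in \<open>R(S\<^sup>p)\<close> for \<open>\<lambda> \<noteq> \<mu>\<close>, so it vanishes near \<open>\<mu>\<close>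
  and hence everywhere. The index on \<open>M = R(S\<^sup>n)\<close> is not positive because
  \<open>K = N(S\<^sup>p\<^sup>+\<^sup>1) \<inter> M\<close> is finite-dimensional and \<open>K / SK\<close>, whose dimension is that of \<open>N(S) \<inter> M\<close>,
  embeds into \<open>M / SM\<close>.

  Conversely, let \<open>S\<close> be upper semi-Fredholm on the closed space \<open>R(S\<^sup>n)\<close>. Then all later ranges are
  closed. If the ascent were infinite, the finite-dimensional spaces \<open>N(S) \<inter> R(S\<^sup>k)\<close> would stabilise
  at a nonzero space, so \<open>S\<close> would map the intersection of all \<open>R(S\<^sup>k)\<close> onto itself with a nontrivial
  kernel, and a power series solution would violate the single-valued extension property. So the
  sign of the index is automatic under that property.
\<close>

section \<open>Hilbert space preliminaries\<close>

text \<open>The norm axioms of \<open>banach\<close> concern real scalars; homogeneity for complex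
  ones is read off from the form through \<open>cinner_self\<close>.\<close>

lemma norm_scaleC: "norm (c *\<^sub>C x) = cmod c * norm (x :: 'a :: complex_hilbert_space)"
proof -
  have "cinner (c *\<^sub>C x) (c *\<^sub>C x) = c * cnj (c * cinner x x)"
    by (metis cinner_scaleC_left cinner_commute)
  also have "\<dots> = complex_of_real ((cmod c * norm x)\<^sup>2)"
    by (simp only: cinner_self complex_norm_square power_mult_distrib of_real_mult complex_cnj_mult
        complex_cnj_complex_of_real mult.assoc)
  finally have "(norm (c *\<^sub>C x))\<^sup>2 = (cmod c * norm x)\<^sup>2"
    by (simp add: cinner_self del: of_real_power)
  then show ?thesis by simp
qed

lemma bounded_bilinear_scaleC:
  "bounded_bilinear (scaleC :: complex \<Rightarrow> 'a :: complex_hilbert_space \<Rightarrow> 'a)"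
proof
  show "(r *\<^sub>R a) *\<^sub>C b = r *\<^sub>R (a *\<^sub>C b)" for r a and b :: 'a
    by (simp only: scaleR_conv_of_real scaleC_of_real[symmetric, of r "a *\<^sub>C b"] scaleC_scaleC)
  show "a *\<^sub>C (r *\<^sub>R b) = r *\<^sub>R (a *\<^sub>C b)" for r a and b :: 'a
    by (simp only: scaleC_of_real[symmetric, where ?'a = 'a] scaleC_scaleC mult.commute)
  show "\<exists>K. \<forall>a b. norm (a *\<^sub>C b :: 'a) \<le> norm a * norm b * K"
    by (rule exI[of _ 1]) (simp add: norm_scaleC)
qed (simp_all add: scaleC_add_left scaleC_add_right)

lemma Cauchy_Schwarz_cinner: "cmod (cinner x y) \<le> norm x * norm y"
proof (cases "y = 0")
  case True
  have "cinner x 0 = cnj (cinner (0 *\<^sub>C 0) x)" by (metis cinner_commute complex_vector.scale_zero_left)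
  also have "cinner (0 *\<^sub>C 0) x = 0" by (simp only: cinner_scaleC_left mult_zero_left)
  finally show ?thesis using True by simp
next
  case False
  define c where "c = cinner x y"
  define d where "d = - c"
  define n where "n = complex_of_real ((norm y)\<^sup>2)"
  define m where "m = complex_of_real ((norm x)\<^sup>2)"
  have add_right: "cinner u (v + w) = cinner u v + cinner u w" for u v w :: 'a
    by (metis cinner_add_left cinner_commute complex_cnj_add)
  have scale_right: "cinner u (d *\<^sub>C v) = cnj d * cinner u v" for u v :: 'a and d
    by (metis cinner_commute cinner_scaleC_left complex_cnj_mult)
  have [simp]: "cinner y x = cnj c" "cinner x y = c" "cinner x x = m" "cinner y y = n"
    by (simp_all add: c_def m_def n_def cinner_commute[of y x] cinner_self)
  \<comment> \<open>Since \<open>d\<close> is minus the inner product of x and y, \<open>?z\<close>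
    is n times the component of x orthogonal to y. Scaling by n avoids a division.\<close>
  let ?z = "n *\<^sub>C x + d *\<^sub>C y"
  have n: "cnj n = n" by (simp add: n_def)
  have "complex_of_real ((norm ?z)\<^sup>2) = n * (n * m - c * cnj c)"
    unfolding cinner_self[symmetric]
    by (simp add: cinner_add_left add_right cinner_scaleC_left scale_right n algebra_simps)
      (simp add: d_def algebra_simps)
  also have "\<dots> = complex_of_real ((norm y)\<^sup>2 * ((norm y)\<^sup>2 * (norm x)\<^sup>2 - (cmod c)\<^sup>2))"
    by (simp only: n_def m_def complex_norm_square of_real_mult of_real_diff)
  finally have "(norm y)\<^sup>2 * ((norm y)\<^sup>2 * (norm x)\<^sup>2 - (cmod c)\<^sup>2) = (norm ?z)\<^sup>2"
    by (simp only: of_real_eq_iff)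
  then have "0 \<le> (norm y)\<^sup>2 * ((norm y)\<^sup>2 * (norm x)\<^sup>2 - (cmod c)\<^sup>2)" by simp
  then have "(cmod c)\<^sup>2 \<le> (norm x * norm y)\<^sup>2"
    using False by (simp add: zero_le_mult_iff power_mult_distrib mult.commute)
  then show ?thesis unfolding c_def by (rule power2_le_imp_le) simp
qed

lemma bounded_linear_cinner_left: "bounded_linear (\<lambda>x :: 'a :: complex_hilbert_space. cinner x y)"
proof (rule bounded_linear_intro)
  show "cinner (r *\<^sub>R x) y = r *\<^sub>R cinner x y" for r and x :: 'a
    by (simp only: scaleC_of_real[symmetric, of r x] cinner_scaleC_left scaleR_conv_of_real)
  show "norm (cinner x y) \<le> norm x * norm y" for x
    by (rule Cauchy_Schwarz_cinner)
qed (rule cinner_add_left)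

lemma complex_subspace_imp_subspace: "complex_vector.subspace V \<Longrightarrow> subspace V"
  unfolding subspace_def complex_vector.subspace_def by (auto simp flip: scaleC_of_real)

lemma bounded_clinear_imp_bounded_linear: "bounded_clinear S \<Longrightarrow> bounded_linear S"
  by (simp add: bounded_clinear_def)

lemma bounded_clinear_imp_clinear: "bounded_clinear S \<Longrightarrow> Vector_Spaces.linear scaleC scaleC S"
  unfolding bounded_clinear_def Vector_Spaces.linear_iff
  by (simp add: complex_vector.vector_space_axioms linear_simps)

lemma bounded_clinear_funpow: "bounded_clinear S \<Longrightarrow> bounded_clinear (S ^^ n)"
  by (induction n) (auto simp: bounded_clinear_def o_def id_def bounded_linear_ident
      intro: bounded_linear_compose)

lemma bounded_clinear_shift: "bounded_clinear T \<Longrightarrow> bounded_clinear (shift T \<mu>)"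
  unfolding bounded_clinear_def shift_def
  using bounded_linear_sub[OF _ bounded_bilinear.bounded_linear_right[OF bounded_bilinear_scaleC, of \<mu>], of T]
  by (simp add: complex_vector.scale_right_diff_distrib scaleC_scaleC mult.commute)

section \<open>The open mapping theorem\<close>

lemma completely_metrizable_space_closed:
  "closed (S :: 'a :: banach set) \<Longrightarrow> completely_metrizable_space (top_of_set S)"
  by (simp add: completely_metrizable_space_closedin completely_metrizable_space_euclidean)

text \<open>Baire category gives the open mapping theorem up to small errors: the complete space
  f(M) is the union of the closed sets \<open>A n\<close>, so one of them contains a relative
  ball.\<close>

lemma bounded_linear_image_absorbs:
  fixes f :: "'a::banach \<Rightarrow> 'b::banach"
  assumes f: "bounded_linear f" and M: "subspace M" and cl: "closed (f ` M)"
  obtains C where "C > 0"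
    "\<And>y \<eta>. y \<in> f ` M \<Longrightarrow> \<eta> > 0 \<Longrightarrow> \<exists>x\<in>M. norm x \<le> C * norm y \<and> norm (y - f x) < \<eta>"
proof -
  interpret bounded_linear f by fact
  define A where "A n = closure (f ` (M \<inter> cball 0 (real n)))" for n
  have fM: "subspace (f ` M)"
    using M by (simp add: linear_subspace_image linear_axioms)
  have "\<exists>n. top_of_set (f ` M) interior_of A n \<noteq> {}"
  proof (rule ccontr)
    assume "\<not> ?thesis"
    moreover have sub: "A n \<subseteq> f ` M" for n
      unfolding A_def by (rule closure_minimal) (use cl in auto)
    moreover have "closedin (top_of_set (f ` M)) (A n)" for n
      using sub A_def by (simp add: closed_subset)
    ultimately have "top_of_set (f ` M) interior_of \<Union>(range A) = {}"
      by (intro Baire_category_alt) (auto simp: completely_metrizable_space_closed cl)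
    moreover have "\<Union>(range A) = f ` M"
    proof
      show "f ` M \<subseteq> \<Union>(range A)"
      proof safe
        fix x assume "x \<in> M"
        moreover obtain n where "norm x \<le> real n" using real_arch_simple by blast
        ultimately have "f x \<in> A n" unfolding A_def by (intro closure_subset[THEN subsetD]) auto
        then show "f x \<in> \<Union>(range A)" by auto
      qed
    qed (use sub in auto)
    ultimately have "f ` M = {}"
      using interior_of_topspace[of "top_of_set (f ` M)"] by simp
    then show False using M subspace_0 by auto
  qed
  then obtain n y0 where "y0 \<in> top_of_set (f ` M) interior_of A n" by auto
  then obtain U where U: "openin (top_of_set (f ` M)) U" "U \<subseteq> A n" "y0 \<in> U"
    unfolding interior_of_def by auto
  then obtain e where e: "e > 0" "ball y0 e \<inter> f ` M \<subseteq> A n" and y0: "y0 \<in> f ` M"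
    unfolding openin_contains_ball by blast
  \<comment> \<open>A vector of length e/2 in f(M) is a difference of two points of this ball, hence
    approximated by images of vectors of norm at most 2n. Rescaling to y gives 4n/e; the added 1
    keeps \<open>C\<close> positive for n = 0.\<close>
  define C where "C = 4 * (real n + 1) / e"
  show ?thesis
  proof (rule that)
    show "C > 0" using e by (simp add: C_def)
    fix y \<eta> assume y: "y \<in> f ` M" and \<eta>: "\<eta> > (0::real)"
    show "\<exists>x\<in>M. norm x \<le> C * norm y \<and> norm (y - f x) < \<eta>"
    proof (cases "y = 0")
      case True
      then show ?thesis using M \<eta> subspace_0 zero by (intro bexI[of _ 0]) auto
    next
      case False
      define t where "t = e / (2 * norm y)"
      have t: "t > 0" using e False by (simp add: t_def)
      have "norm (t *\<^sub>R y) < e" using e False by (simp add: t_def)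
      then have "y0 + t *\<^sub>R y \<in> A n"
        using e(2) y y0 fM by (auto simp: subspace_add subspace_scale dist_norm)
      moreover have "y0 \<in> A n" using e y0 by auto
      moreover have "t * \<eta> / 2 > 0" using t \<eta> by simp
      ultimately obtain u v where
        u: "u \<in> M" "norm u \<le> real n" "dist (f u) (y0 + t *\<^sub>R y) < t * \<eta> / 2" and
        v: "v \<in> M" "norm v \<le> real n" "dist (f v) y0 < t * \<eta> / 2"
        unfolding A_def closure_approachable by (smt (verit) IntE image_iff mem_cball_0)
      \<comment> \<open>f u is near y0 + t y and f v is near y0, so f (u - v) is near t y. The two
        errors below t \<eta> / 2 add up to less than \<eta> after division by t.\<close>
      let ?x = "(1 / t) *\<^sub>R (u - v)"
      have "?x \<in> M" using u v M by (simp add: subspace_diff subspace_scale)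
      moreover have "norm ?x \<le> C * norm y"
      proof -
        have "norm (u - v) \<le> 2 * real n" using norm_triangle_ineq4[of u v] u v by linarith
        then have "norm ?x \<le> 1 / t * (2 * (real n + 1))"
          using t by (simp add: divide_right_mono)
        also have "\<dots> = C * norm y" by (simp add: t_def C_def)
        finally show ?thesis .
      qed
      moreover have "norm (y - f ?x) < \<eta>"
      proof -
        have "t *\<^sub>R (y - f ?x) = (f v - y0) - (f u - (y0 + t *\<^sub>R y))"
          using t by (simp add: scaleR diff algebra_simps)
        then have "t * norm (y - f ?x) \<le> norm (f v - y0) + norm (f u - (y0 + t *\<^sub>R y))"
          using t norm_triangle_ineq4 by (metis abs_of_pos norm_scaleR)
        also have "\<dots> < t * \<eta>" using u v by (simp add: dist_norm)
        finally show ?thesis using t by simp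
      qed
      ultimately show ?thesis by blast
    qed
  qed
qed

text \<open>Successive approximation: each correction at least halves the remaining error, and the
  corrections form a geometrically dominated series whose sum stays in the closed M.\<close>

lemma bounded_linear_open_mapping:
  fixes f :: "'a::banach \<Rightarrow> 'b::banach"
  assumes f: "bounded_linear f" and M: "subspace M" "closed M" and cl: "closed (f ` M)"
  obtains C where "C > 0" "\<And>y. y \<in> f ` M \<Longrightarrow> \<exists>x\<in>M. f x = y \<and> norm x \<le> C * norm y"
proof -
  interpret bounded_linear f by fact
  have fM: "subspace (f ` M)"
    using M by (simp add: linear_subspace_image linear_axioms)
  obtain C where C: "C > 0"
    "\<And>y \<eta>. y \<in> f ` M \<Longrightarrow> \<eta> > 0 \<Longrightarrow> \<exists>x\<in>M. norm x \<le> C * norm y \<and> norm (y - f x) < \<eta>"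
    using bounded_linear_image_absorbs[OF f M(1) cl] by metis
  have "\<exists>x. x \<in> M \<and> norm x \<le> C * norm y \<and> norm (y - f x) \<le> norm y / 2" if "y \<in> f ` M" for y
  proof (cases "y = 0")
    case True
    then show ?thesis using M subspace_0 zero by (intro exI[of _ 0]) auto
  next
    case False
    then show ?thesis using C(2)[OF that, of "norm y / 2"] by (auto simp: less_imp_le)
  qed
  then obtain g where g: "\<And>y. y \<in> f ` M \<Longrightarrow> g y \<in> M \<and> norm (g y) \<le> C * norm y \<and> norm (y - f (g y)) \<le> norm y / 2"
    by metis
  show ?thesis
  proof (rule that)
    show "2 * C > 0" using C by simp
    fix y assume y: "y \<in> f ` M"
    \<comment> \<open>\<open>r n\<close> is the error left after n corrections; the sums of the f (g
      (r i)) telescope to y - r n.\<close>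
    define r where "r n = ((\<lambda>z. z - f (g z)) ^^ n) y" for n
    have r_Suc: "r (Suc n) = r n - f (g (r n))" for n by (simp add: r_def)
    have rM: "r n \<in> f ` M" for n
    proof (induction n)
      case (Suc n)
      then show ?case unfolding r_Suc using g fM by (intro subspace_diff) auto
    qed (simp add: r_def y)
    have r_le: "norm (r n) \<le> norm y * (1/2) ^ n" for n
    proof (induction n)
      case (Suc n)
      then show ?case using g[OF rM, of n] by (simp add: r_Suc)
    qed (simp add: r_def)
    have gr: "norm (g (r n)) \<le> C * norm y * (1/2) ^ n" for n
    proof -
      have "norm (g (r n)) \<le> C * norm (r n)" using g rM by blast
      also have "\<dots> \<le> C * (norm y * (1/2) ^ n)" using r_le C by (intro mult_left_mono) auto
      finally show ?thesis by (simp add: mult.assoc)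
    qed
    have geo: "(\<lambda>n. C * norm y * (1/2) ^ n) sums (C * norm y * 2)"
      using geometric_sums[of "1/2::real"] by (intro sums_mult) auto
    have sm: "summable (\<lambda>n. g (r n))"
      by (rule summable_comparison_test'[OF sums_summable[OF geo] gr])
    let ?x = "\<Sum>n. g (r n)"
    have "?x \<in> M"
    proof (rule closed_sequentially[OF M(2)])
      show "(\<Sum>i<n. g (r i)) \<in> M" for n using g rM M by (intro subspace_sum) auto
      show "(\<lambda>n. \<Sum>i<n. g (r i)) \<longlonglongrightarrow> ?x" using sm summable_LIMSEQ by blast
    qed
    moreover have "f ?x = y"
    proof -
      have "(\<Sum>i<n. f (g (r i))) = y - r n" for n
        by (induction n) (simp_all add: r_Suc, simp add: r_def)
      moreover have "r \<longlonglongrightarrow> 0"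
      proof (rule Lim_null_comparison)
        show "\<forall>\<^sub>F n in sequentially. norm (r n) \<le> norm y * (1/2) ^ n" using r_le by auto
        show "(\<lambda>n. norm y * (1/2) ^ n) \<longlonglongrightarrow> 0"
          by (intro tendsto_mult_right_zero LIMSEQ_power_zero) auto
      qed
      then have "(\<lambda>n. y - r n) \<longlonglongrightarrow> y - 0" by (intro tendsto_intros)
      ultimately have "(\<lambda>n. f (g (r n))) sums y" by (simp add: sums_def)
      then show ?thesis using suminf[OF sm] sums_unique by metis
    qed
    moreover have "norm ?x \<le> 2 * C * norm y"
    proof -
      have sn: "summable (\<lambda>n. norm (g (r n)))"
        using gr by (intro summable_comparison_test'[OF sums_summable[OF geo]]) simp
      have "norm ?x \<le> (\<Sum>n. norm (g (r n)))" by (rule summable_norm[OF sn])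
      also have "\<dots> \<le> C * norm y * 2"
        using suminf_le[OF gr sn sums_summable[OF geo]] sums_unique[OF geo] by simp
      finally show ?thesis by simp
    qed
    ultimately show "\<exists>x\<in>M. f x = y \<and> norm x \<le> 2 * C * norm y" by blast
  qed
qed

section \<open>Kernels and cokernels of linear maps\<close>

context vector_space
begin

interpretation endo: vector_space_pair scale scale by unfold_locales

text \<open>The linear map that kills A and fixes B acts on a common vector of the two spans both as
  zero and as the identity.\<close>

lemma span_Int_span_independent_Un:
  assumes "independent (A \<union> B)" "A \<inter> B = {}"
  shows "span A \<inter> span B = {0}"
proof -
  obtain f where f: "Vector_Spaces.linear scale scale f"
    and fx: "\<And>x. x \<in> A \<union> B \<Longrightarrow> f x = (if x \<in> A then 0 else x)"
    using endo.linear_independent_extend[OF assms(1), of "\<lambda>x. if x \<in> A then 0 else x"] by blast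
  have "x = 0" if "x \<in> span A" "x \<in> span B" for x
  proof -
    have "f x = 0"
      using endo.linear_eq_0_on_span[OF f _ that(1)] fx by simp
    moreover have "f x = id x"
      by (rule endo.linear_eq_on[OF f linear_id that(2)]) (use fx assms(2) in auto)
    ultimately show ?thesis by simp
  qed
  then show ?thesis by (auto simp: span_zero)
qed

lemma independent_Un:
  assumes A: "independent A" and B: "independent B" and int: "span A \<inter> span B \<subseteq> {0}"
  shows "independent (A \<union> B)"
proof
  assume "dependent (A \<union> B)"
  then obtain t u v where t: "finite t" "t \<subseteq> A \<union> B" and u: "(\<Sum>v\<in>t. scale (u v) v) = 0"
    and v: "v \<in> t" "u v \<noteq> 0"
    unfolding dependent_explicit by blast
  let ?a = "\<Sum>v\<in>t \<inter> A. scale (u v) v" and ?b = "\<Sum>v\<in>t - A. scale (u v) v"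
  have ab: "?a + ?b = 0"
    using u sum.Int_Diff[OF t(1), of _ A] by metis
  have a: "?a \<in> span A" by (intro span_sum span_scale span_base) auto
  have b: "?b \<in> span B" by (intro span_sum span_scale span_base) (use t in auto)
  have "?a = - ?b" using ab by (simp add: eq_neg_iff_add_eq_0)
  then have "?a \<in> span B" using b span_neg by metis
  with a int have a0: "?a = 0" by blast
  with ab have b0: "?b = 0" by simp
  show False
  proof (cases "v \<in> A")
    case True
    then show False using independentD[OF A _ _ a0, of v] t v by auto
  next
    case False
    have "t - A \<subseteq> B" using t by blast
    then show False using independentD[OF B _ _ b0, of v] t v False by auto
  qed
qed

text \<open>A linear right inverse g of f on V splits x into g (f x), spanned by the lifts of
  \<open>B\<^sub>1\<close>, and the kernel vector x - g (f x).\<close>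

lemma finite_spanning_set_of_kernel_image:
  assumes f: "Vector_Spaces.linear scale scale f" and V: "subspace V"
    and "finite B\<^sub>0" "{x \<in> V. f x = 0} \<subseteq> span B\<^sub>0"
    and "finite B\<^sub>1" "f ` V \<subseteq> span B\<^sub>1"
  shows "\<exists>B. finite B \<and> V \<subseteq> span B"
proof -
  obtain g where g: "range g \<subseteq> V" "Vector_Spaces.linear scale scale g" "\<And>y. y \<in> f ` V \<Longrightarrow> f (g y) = y"
    using endo.linear_exists_right_inverse_on[OF f V] by blast
  have "x \<in> span (B\<^sub>0 \<union> g ` B\<^sub>1)" if "x \<in> V" for x
  proof -
    have "f (x - g (f x)) = 0" using g(3) that by (simp add: endo.linear_diff[OF f])
    moreover have "x - g (f x) \<in> V" using that g(1) V by (intro subspace_diff) auto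
    ultimately have "x - g (f x) \<in> span B\<^sub>0" using assms(4) by blast
    moreover have "g (f x) \<in> span (g ` B\<^sub>1)"
      using assms(6) that unfolding endo.linear_span_image[OF g(2)] by auto
    ultimately have "(x - g (f x)) + g (f x) \<in> span (B\<^sub>0 \<union> g ` B\<^sub>1)"
      unfolding span_Un by blast
    then show ?thesis by simp
  qed
  then show ?thesis using assms(3,5) by (intro exI[of _ "B\<^sub>0 \<union> g ` B\<^sub>1"]) auto
qed

text \<open>Rank-nullity on the finite-dimensional K identifies the dimension of the kernel with
  that of K / f(K). The last inclusion in \<open>sub\<close> makes K / f(K) embed into M / f(M),
  which the cosets of B span.\<close>

lemma dim_kernel_le_card_coset_spanning:
  assumes f: "Vector_Spaces.linear scale scale f" and K: "subspace K" and M: "subspace M"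
    and fin: "finite F" "K \<subseteq> span F"
    and sub: "K \<subseteq> M" "f ` K \<subseteq> K" "K \<inter> f ` M \<subseteq> f ` K"
    and B: "finite B" "M \<subseteq> span (f ` M \<union> B)"
  shows "dim {x \<in> K. f x = 0} \<le> card B"
proof -
  let ?Z = "{x \<in> K. f x = 0}"
  have fin_ind: "finite X" if "independent X" "X \<subseteq> K" for X
    using independent_span_bound[OF fin(1) that(1)] that(2) fin(2) by blast
  obtain A where A: "A \<subseteq> ?Z" "independent A" "card A = dim ?Z"
    using basis_exists[of ?Z] by metis
  obtain D where D: "D \<subseteq> f ` K" "independent D" "f ` K \<subseteq> span D"
    using maximal_independent_subset by metis
  have DK: "D \<subseteq> K" using D sub by blast
  obtain X where X: "D \<subseteq> X" "X \<subseteq> K" "independent X" "K \<subseteq> span X"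
    using maximal_independent_subset_extend[OF DK D(2)] by metis
  \<comment> \<open>X extends the basis D of f(K) to a basis of K, so \<open>C\<close> represents a
    basis of K / f(K).\<close>
  define C where "C = X - D"
  have finX: "finite X" using fin_ind X by blast
  then have cardX: "card X = card D + card C"
    using X(1) by (auto simp: C_def finite_subset card_Diff_subset card_mono)
  have indC: "independent C" and CK: "C \<subseteq> K"
    using independent_mono[OF X(3), of C] X(2) by (auto simp: C_def)

  \<comment> \<open>The inequality needed from rank-nullity: the kernel basis A and the lifts of D
    are jointly independent in K, so A has at most as many elements as C.\<close>
  obtain g where g: "range g \<subseteq> K" "Vector_Spaces.linear scale scale g" "\<And>y. y \<in> f ` K \<Longrightarrow> f (g y) = y"
    using endo.linear_exists_right_inverse_on[OF f K] by blast
  have spanD: "span D = f ` K"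
    using D endo.linear_subspace_image[OF f K] by (intro span_subspace)
  have inj: "inj_on g (span D)"
    using g(3) spanD by (intro inj_on_inverseI[of _ f]) simp
  have indgD: "independent (g ` D)"
    by (rule endo.linear_independent_injective_image[OF g(2) D(2) inj])
  have spanA: "f x = 0" if "x \<in> span A" for x
    using endo.linear_eq_0_on_span[OF f _ that] A(1) by auto
  have gD: "span A \<inter> span (g ` D) \<subseteq> {0}"
  proof
    fix x assume x: "x \<in> span A \<inter> span (g ` D)"
    then obtain y where y: "y \<in> span D" "x = g y"
      using endo.linear_span_image[OF g(2)] by auto
    have "f x = y" using g(3)[of y] spanD y by simp
    then have "y = 0" using spanA[of x] x by simp
    with \<open>x = g y\<close> show "x \<in> {0}" by (simp add: endo.linear_0[OF g(2)])
  qed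
  have ind: "independent (A \<union> g ` D)"
    by (rule independent_Un[OF A(2) indgD gD])
  have sub': "A \<union> g ` D \<subseteq> K" using A g by auto
  have "A \<inter> g ` D = {}"
  proof -
    have False if "d \<in> D" "g d \<in> A" for d
    proof -
      have "f (g d) = 0" using that A by auto
      with that D g(3) have "d = 0" by auto
      with that D(2) show False using dependent_zero by blast
    qed
    then show ?thesis by blast
  qed
  moreover have "card (g ` D) = card D"
    using inj_on_subset[OF inj span_superset] by (rule card_image)
  ultimately have "card A + card D = card (A \<union> g ` D)"
    using fin_ind[OF ind sub'] by (simp add: card_Un_disjoint)
  also have "\<dots> \<le> card X"
    using independent_span_bound[OF finX ind] sub' X(4) by blast
  finally have AC: "card A \<le> card C" using cardX by simp

  obtain E where E: "E \<subseteq> f ` M" "independent E" "f ` M \<subseteq> span E"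
    using maximal_independent_subset by metis
  have spanE: "span E = f ` M"
    using E endo.linear_subspace_image[OF f M] by (intro span_subspace)
  have spanC: "span C \<subseteq> K" using CK K by (rule span_minimal)
  have "D \<union> C = X" "D \<inter> C = {}" using X by (auto simp: C_def)
  then have DC: "span D \<inter> span C = {0}"
    using span_Int_span_independent_Un X(3) by metis
  \<comment> \<open>C stays independent modulo f(M): a vector of its span that lies in f(M) already
    lies in f(K), the span of D.\<close>
  have EC: "span E \<inter> span C \<subseteq> {0}"
  proof
    fix x assume x: "x \<in> span E \<inter> span C"
    then have "x \<in> K \<inter> f ` M" using spanC spanE by auto
    then have "x \<in> span D" using sub(3) spanD by auto
    then show "x \<in> {0}" using x DC by auto
  qed
  have indEC: "independent (E \<union> C)"
    by (rule independent_Un[OF E(2) indC EC])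
  have disj: "E \<inter> C = {}"
  proof -
    have "0 \<notin> C" using indC dependent_zero by metis
    moreover have "x = 0" if "x \<in> E" "x \<in> C" for x
      using EC span_base[OF that(1)] span_base[OF that(2)] by auto
    ultimately show ?thesis by auto
  qed
  \<comment> \<open>h plays the role of the quotient map modulo f(M). It sends a set spanning M
    modulo f(M) to one spanned by the image of B, but leaves C fixed.\<close>
  obtain h where h: "Vector_Spaces.linear scale scale h"
    and hx: "\<And>x. x \<in> E \<union> C \<Longrightarrow> h x = (if x \<in> E then 0 else x)"
    using endo.linear_independent_extend[OF indEC, of "\<lambda>x. if x \<in> E then 0 else x"] by blast
  have h0: "h y = 0" if "y \<in> E" for y
    using hx[of y] that by simp
  have hE: "h x = 0" if "x \<in> f ` M" for x
  proof -
    have xE: "x \<in> span E" by (rule subsetD[OF E(3) that])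
    show ?thesis by (rule endo.linear_eq_0_on_span[OF h h0 xE])
  qed
  have "C \<subseteq> span (h ` B)"
  proof
    fix c assume c: "c \<in> C"
    have "c \<in> span (f ` M \<union> B)" using c CK sub(1) B(2) by blast
    then have hc: "h c \<in> span (h ` (f ` M \<union> B))"
      using endo.linear_span_image[OF h, of "f ` M \<union> B"] by simp
    have "h ` (f ` M \<union> B) \<subseteq> span (h ` B)"
    proof (rule image_subsetI)
      fix x assume "x \<in> f ` M \<union> B"
      then show "h x \<in> span (h ` B)"
      proof
        assume "x \<in> f ` M"
        then show ?thesis by (simp only: hE span_zero)
      next
        assume "x \<in> B"
        then show ?thesis by (rule span_base[OF imageI])
      qed
    qed
    then have "span (h ` (f ` M \<union> B)) \<subseteq> span (h ` B)"
      by (rule span_minimal[OF _ subspace_span])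
    then have "h c \<in> span (h ` B)" using hc by blast
    moreover have "h c = c" using hx[of c] c disj by (metis UnI2 disjoint_iff)
    ultimately show "c \<in> span (h ` B)" by simp
  qed
  then have "card C \<le> card (h ` B)"
    using independent_span_bound[of "h ` B" C] indC B(1) by simp
  also have "\<dots> \<le> card B" using B(1) by (rule card_image_le)
  finally show ?thesis using AC A(3) by simp
qed

text \<open>A basis of V extends to a basis of W, finite because of F, and the dimensions leave no
  room for a new vector.\<close>

lemma subspace_eq_of_dim_ge:
  assumes "subspace V" "V \<subseteq> W" "finite F" "W \<subseteq> span F" "dim W \<le> dim V"
  shows "V = W"
proof -
  obtain A where A: "A \<subseteq> V" "independent A" "V \<subseteq> span A" "card A = dim V"
    using basis_exists by metis
  have "A \<subseteq> W" using A(1) assms(2) by (rule subset_trans)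
  then obtain B where B: "A \<subseteq> B" "B \<subseteq> W" "independent B" "W \<subseteq> span B"
    using maximal_independent_subset_extend[OF _ A(2)] by metis
  have "B \<subseteq> span F" using B(2) assms(4) by (rule subset_trans)
  then have "finite B" using independent_span_bound[OF assms(3) B(3)] by simp
  moreover have "card B = dim W" by (rule basis_card_eq_dim[OF B(2,4,3)])
  ultimately have "A = B"
    using card_seteq[of B A] B(1) A(4) assms(5) by simp
  then have "W \<subseteq> V" using B(4) span_minimal[OF A(1) assms(1)] by simp
  with assms(2) show ?thesis by (rule subset_antisym)
qed

end

section \<open>Closed ranges and ascent\<close>

text \<open>If x is outside the closed V, its distance \<delta> from V is positive and controls the
  coefficient of x. Along a convergent sequence the coefficients are therefore Cauchy, and the
  V-parts converge too.\<close>

lemma closed_complex_span_insert: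
  fixes V :: "'a :: complex_hilbert_space set"
  assumes V: "complex_vector.subspace V" "closed V"
  shows "closed (complex_vector.span (insert x V))"
proof (cases "x \<in> V")
  case True
  then have "complex_vector.span (insert x V) = V"
    using V(1) by (simp add: insert_absorb)
  then show ?thesis using V by simp
next
  case False
  then obtain \<delta> where \<delta>: "\<delta> > 0" "ball x \<delta> \<subseteq> - V"
    using V(2) open_contains_ball[of "- V"] by auto
  then have \<delta>_le: "\<delta> \<le> norm (x - v)" if "v \<in> V" for v
    using that by (force simp: dist_norm not_less[symmetric])
  have bound: "cmod c * \<delta> \<le> norm (v + c *\<^sub>C x)" if "v \<in> V" for v c
  proof (cases "c = 0")
    case False
    have "v + c *\<^sub>C x = c *\<^sub>C (x - (- inverse c) *\<^sub>C v)"
      using False by (simp add: scaleC_add_right scaleC_scaleC scaleC_one)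
    moreover have "\<delta> \<le> norm (x - (- inverse c) *\<^sub>C v)"
      by (intro \<delta>_le complex_vector.subspace_scale V that)
    ultimately show ?thesis by (metis norm_scaleC mult_left_mono norm_ge_zero)
  qed auto
  show ?thesis
    unfolding closed_sequential_limits
  proof (intro allI impI, elim conjE)
    fix y l assume y: "\<forall>n. y n \<in> complex_vector.span (insert x V)" and l: "y \<longlonglongrightarrow> l"
    have "complex_vector.span V = V" using V(1) complex_vector.span_eq_iff by blast
    then have "\<exists>k. y n - k *\<^sub>C x \<in> V" for n
      using y complex_vector.span_breakdown_eq[of "y n" x V] by metis
    then obtain c where c: "\<And>n. y n - c n *\<^sub>C x \<in> V"
      by metis
    have c_diff: "cmod (c m - c n) * \<delta> \<le> norm (y m - y n)" for m n
      using bound[OF complex_vector.subspace_diff[OF V(1) c[of m] c[of n]], of "c m - c n"]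
      by (simp add: complex_vector.scale_left_diff_distrib)
    have "Cauchy c"
    proof (rule CauchyI)
      fix e :: real assume "e > 0"
      then have "e * \<delta> > 0" using \<delta> by simp
      then obtain N where N: "\<forall>m\<ge>N. \<forall>n\<ge>N. norm (y m - y n) < e * \<delta>"
        using LIMSEQ_imp_Cauchy[OF l] CauchyD by blast
      have "norm (c m - c n) < e" if "m \<ge> N" "n \<ge> N" for m n
        using c_diff[of m n] N that \<delta>(1) by (meson le_less_trans mult_less_cancel_right_pos)
      then show "\<exists>M. \<forall>m\<ge>M. \<forall>n\<ge>M. norm (c m - c n) < e" by blast
    qed
    then obtain d where "c \<longlonglongrightarrow> d" using Cauchy_convergent convergent_def by blast
    then have "(\<lambda>n. y n - c n *\<^sub>C x) \<longlonglongrightarrow> l - d *\<^sub>C x"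
      by (intro tendsto_diff l bounded_bilinear.tendsto[OF bounded_bilinear_scaleC] tendsto_const)
    then have lV: "l - d *\<^sub>C x \<in> V"
      using c closed_sequentially[OF V(2), of "\<lambda>n. y n - c n *\<^sub>C x"] by blast
    have "V \<subseteq> complex_vector.span V" by (rule complex_vector.span_superset)
    then show "l \<in> complex_vector.span (insert x V)"
      using lV complex_vector.span_breakdown_eq[of l x V] by blast
  qed
qed

lemma closed_complex_span_Un_finite:
  fixes V :: "'a :: complex_hilbert_space set"
  assumes "finite B" "complex_vector.subspace V" "closed V"
  shows "closed (complex_vector.span (V \<union> B))"
  using assms(1)
proof induction
  case empty
  have "complex_vector.span V = V" using assms(2) complex_vector.span_eq_iff by blast
  then show ?case using assms by (simp only: Un_empty_right)
next
  case (insert x B)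
  have "complex_vector.span (V \<union> insert x B) = complex_vector.span (insert x (complex_vector.span (V \<union> B)))"
    by (simp only: Un_insert_right complex_vector.span_insert complex_vector.span_span)
  then show ?case
    using closed_complex_span_insert[OF complex_vector.subspace_span insert.IH] by simp
qed

section \<open>Images of closed subspaces under upper semi-Fredholm restrictions\<close>

lemma subspace_null_space:
  assumes "bounded_clinear S"
  shows "complex_vector.subspace (null_space S)"
proof -
  interpret S: Vector_Spaces.linear scaleC scaleC S using assms by (rule bounded_clinear_imp_clinear)
  show ?thesis unfolding null_space_def by (rule S.subspace_kernel)
qed

text \<open>The set in \<open>finite_cdim\<close> may lie outside V; a maximal independent subset of
  V replaces it.\<close>

lemma finite_cdimE:
  assumes "finite_cdim V"
  obtains A where "finite A" "A \<subseteq> V" "V \<subseteq> complex_vector.span A"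
proof -
  obtain B where B: "finite B" "V \<subseteq> complex_vector.span B"
    using assms finite_cdim_def by blast
  obtain A where A: "A \<subseteq> V" "complex_vector.independent A" "V \<subseteq> complex_vector.span A"
    by (rule complex_vector.maximal_independent_subset)
  then have "finite A" using complex_vector.independent_span_bound[OF B(1)] B(2) by blast
  then show ?thesis using A that by blast
qed

text \<open>Adding the finite-dimensional kernel to V changes neither its image nor its closedness.
  Once the kernel is contained, every preimage in M of an image vector lies in the enlarged space,
  so limits can be taken there.\<close>

lemma closed_image_closed_subspace:
  assumes S: "bounded_clinear S" and M: "complex_vector.subspace M" "closed M" "closed (S ` M)"
    and fin: "finite_cdim (null_space S \<inter> M)"
    and V: "V \<subseteq> M" "complex_vector.subspace V" "closed V"
  shows "closed (S ` V)"
proof -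
  interpret S: bounded_linear S using S by (rule bounded_clinear_imp_bounded_linear)
  obtain A where A: "finite A" "A \<subseteq> null_space S \<inter> M" "null_space S \<inter> M \<subseteq> complex_vector.span A"
    using finite_cdimE[OF fin] by metis
  define V' where "V' = complex_vector.span (V \<union> A)"
  have V': "closed V'" "V \<subseteq> V'" "complex_vector.subspace V'" "null_space S \<inter> M \<subseteq> V'"
    unfolding V'_def
    using closed_complex_span_Un_finite[OF A(1) V(2,3)] A(3) complex_vector.span_superset[of "V \<union> A"]
      complex_vector.span_mono[of A "V \<union> A"] by auto
  have "S ` V' \<subseteq> S ` V"
  proof
    fix y assume "y \<in> S ` V'"
    moreover have "complex_vector.span V = V" using V(2) complex_vector.span_eq_iff by blast
    ultimately obtain v z where vz: "v \<in> V" "z \<in> complex_vector.span A" "y = S (v + z)"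
      unfolding V'_def complex_vector.span_Un by auto
    have "complex_vector.span A \<subseteq> null_space S"
      using A(2) subspace_null_space[OF S] by (intro complex_vector.span_minimal) auto
    then show "y \<in> S ` V" using vz by (auto simp: S.add null_space_def)
  qed
  then have SV: "S ` V = S ` V'" using V'(2) by blast
  obtain C where C: "C > 0" "\<And>y. y \<in> S ` M \<Longrightarrow> \<exists>x\<in>M. S x = y \<and> norm x \<le> C * norm y"
    using bounded_linear_open_mapping[OF S.bounded_linear_axioms complex_subspace_imp_subspace[OF M(1)] M(2,3)]
    by metis
  show ?thesis
    unfolding closed_sequential_limits
  proof (intro allI impI, elim conjE)
    fix y l assume y: "\<forall>n. y n \<in> S ` V" and l: "y \<longlonglongrightarrow> l"
    then have "l \<in> S ` M" using V(1) closed_sequentially[OF M(3)] by (meson image_mono subsetD)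
    then obtain m where m: "m \<in> M" "l = S m" by blast
    obtain v where v: "\<And>n. v n \<in> V" "\<And>n. y n = S (v n)" using y unfolding image_iff by metis
    have "l - y n \<in> S ` M" for n
      using v V(1) m M(1) by (auto simp: S.diff[symmetric] intro!: imageI complex_vector.subspace_diff)
    then have "\<exists>u. u \<in> M \<and> S u = l - y n \<and> norm u \<le> C * norm (l - y n)" for n
      using C(2) by blast
    then obtain u where u: "\<And>n. u n \<in> M" "\<And>n. S (u n) = l - y n" "\<And>n. norm (u n) \<le> C * norm (l - y n)"
      by metis
    have "(\<lambda>n. C * dist (y n) l) \<longlonglongrightarrow> 0"
      by (rule tendsto_mult_right_zero[OF tendsto_dist_iff[THEN iffD1, OF l]])
    then have "(\<lambda>n. C * norm (l - y n)) \<longlonglongrightarrow> 0"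
      by (simp add: dist_norm norm_minus_commute)
    then have "u \<longlonglongrightarrow> 0"
      using u(3) by (intro Lim_null_comparison[of u "\<lambda>n. C * norm (l - y n)"]) auto
    then have "(\<lambda>n. m - u n) \<longlonglongrightarrow> m - 0" by (rule tendsto_diff[OF tendsto_const])
    \<comment> \<open>S (m - u n) = y n = S (v n), so m - u n differs from v n by a kernel vector in
      M.\<close>
    moreover have "m - u n \<in> V'" for n
    proof -
      have "m - u n - v n \<in> null_space S \<inter> M"
        using m u(1,2) v V(1) M(1)
        by (auto simp: null_space_def S.diff intro!: complex_vector.subspace_diff)
      then have "(m - u n - v n) + v n \<in> V'"
        using V' v by (intro complex_vector.subspace_add) auto
      then show ?thesis by simp
    qed
    ultimately have "m \<in> V'" using closed_sequentially[OF V'(1), of "\<lambda>n. m - u n"] by simp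
    then show "l \<in> S ` V" using SV m by blast
  qed
qed

section \<open>Ranges and null spaces of powers\<close>

lemma range_funpow_Suc: "range (S ^^ Suc n) = S ` range (S ^^ n)"
  by (simp add: image_comp)

lemma range_funpow_antimono:
  fixes S :: "'a \<Rightarrow> 'a"
  assumes "m \<le> n"
  shows "range (S ^^ n) \<subseteq> range (S ^^ m)"
proof -
  have "S ^^ n = S ^^ m \<circ> S ^^ (n - m)" using assms funpow_add[of m "n - m" S] by simp
  then show ?thesis by auto
qed

lemma subspace_range_funpow:
  assumes "bounded_clinear S"
  shows "complex_vector.subspace (range (S ^^ n))"
proof -
  interpret S: Vector_Spaces.linear scaleC scaleC "S ^^ n"
    using assms by (intro bounded_clinear_imp_clinear bounded_clinear_funpow)
  show ?thesis by (intro S.subspace_image complex_vector.subspace_UNIV)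
qed

lemma null_space_funpow_stable:
  assumes S: "bounded_clinear S" and p: "null_space (S ^^ p) = null_space (S ^^ Suc p)" and "p \<le> k"
  shows "null_space (S ^^ k) = null_space (S ^^ Suc k)"
  using assms(3)
proof (induction rule: dec_induct)
  case (step k)
  have "S 0 = 0" using S bounded_clinear_imp_bounded_linear linear_simps(3) by blast
  have "x \<in> null_space (S ^^ Suc n) \<longleftrightarrow> S x \<in> null_space (S ^^ n)" for x n
    by (simp add: null_space_def funpow_swap1)
  then show ?case using step.IH by blast
qed (rule p)

text \<open>If S kills (S^p) x, then x is in N(S^(p+1)) = N(S^p), so (S^p) x is already 0. Stable
  null spaces thus mean that S is injective on R(S^p).\<close>

lemma null_space_Int_range_funpow:
  assumes S: "bounded_clinear S" and p: "null_space (S ^^ p) = null_space (S ^^ Suc p)"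
  shows "null_space S \<inter> range (S ^^ p) = {0}"
proof -
  have "(S ^^ p) 0 = 0"
    using bounded_clinear_funpow[OF S] bounded_clinear_imp_bounded_linear linear_simps(3) by blast
  moreover have "S 0 = 0" using S bounded_clinear_imp_bounded_linear linear_simps(3) by blast
  ultimately show ?thesis using p unfolding null_space_def by (auto intro: range_eqI[of _ _ 0])
qed

text \<open>Applying S moves the convergent sequence into the closed range of S^(p+1), where bounded
  preimages of the differences tend to 0. Equality of the null spaces then cancels the extra factor
  S.\<close>

lemma closed_range_funpow_descend:
  assumes S: "bounded_clinear S" and p: "null_space (S ^^ p) = null_space (S ^^ Suc p)"
    and cl: "closed (range (S ^^ Suc p))"
  shows "closed (range (S ^^ p))"
proof -
  interpret S: bounded_linear S using S by (rule bounded_clinear_imp_bounded_linear)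
  interpret Sp: bounded_linear "S ^^ p"
    using S by (intro bounded_clinear_imp_bounded_linear bounded_clinear_funpow)
  interpret Sq: bounded_linear "S ^^ Suc p"
    using S by (intro bounded_clinear_imp_bounded_linear bounded_clinear_funpow)
  obtain C where C: "C > 0" "\<And>y. y \<in> range (S ^^ Suc p) \<Longrightarrow> \<exists>x\<in>UNIV. (S ^^ Suc p) x = y \<and> norm x \<le> C * norm y"
    using bounded_linear_open_mapping[OF Sq.bounded_linear_axioms subspace_UNIV closed_UNIV cl] by metis
  show ?thesis
    unfolding closed_sequential_limits
  proof (intro allI impI, elim conjE)
    fix y l assume y: "\<forall>n. y n \<in> range (S ^^ p)" and l: "y \<longlonglongrightarrow> l"
    obtain v where v: "\<And>n. y n = (S ^^ p) (v n)" using y unfolding image_iff by metis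
    have Sl: "(\<lambda>n. S (y n)) \<longlonglongrightarrow> S l" by (intro S.tendsto l)
    moreover have "S (y n) \<in> range (S ^^ Suc p)" for n using v by auto
    ultimately have "S l \<in> range (S ^^ Suc p)"
      using closed_sequentially[OF cl, of "\<lambda>n. S (y n)"] by blast
    then obtain m where m: "S l = (S ^^ Suc p) m" by blast
    have "S l - S (y n) = (S ^^ Suc p) (m - v n)" for n
      unfolding Sq.diff m[symmetric] using v by simp
    then have "S l - S (y n) \<in> range (S ^^ Suc p)" for n by simp
    then have "\<exists>u. (S ^^ Suc p) u = S l - S (y n) \<and> norm u \<le> C * norm (S l - S (y n))" for n
      using C(2) by blast
    then obtain u where u: "\<And>n. (S ^^ Suc p) (u n) = S l - S (y n)" "\<And>n. norm (u n) \<le> C * norm (S l - S (y n))"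
      by metis
    have "(\<lambda>n. C * dist (S (y n)) (S l)) \<longlonglongrightarrow> 0"
      by (rule tendsto_mult_right_zero[OF tendsto_dist_iff[THEN iffD1, OF Sl]])
    then have "(\<lambda>n. C * norm (S l - S (y n))) \<longlonglongrightarrow> 0"
      by (simp add: dist_norm norm_minus_commute)
    then have "u \<longlonglongrightarrow> 0"
      using u(2) by (intro Lim_null_comparison[of u "\<lambda>n. C * norm (S l - S (y n))"]) auto
    then have "(\<lambda>n. (S ^^ p) m - (S ^^ p) (u n)) \<longlonglongrightarrow> (S ^^ p) m - (S ^^ p) 0"
      by (rule tendsto_diff[OF tendsto_const Sp.tendsto])
    moreover have "(S ^^ p) m - (S ^^ p) (u n) = y n" for n
    proof -
      have "m - v n - u n \<in> null_space (S ^^ Suc p)"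
        using u(1)[of n] m v[of n] unfolding null_space_def by (simp add: Sp.diff S.diff)
      then have "m - v n - u n \<in> null_space (S ^^ p)" using p by simp
      then have "(S ^^ p) m - (S ^^ p) (v n) = (S ^^ p) (u n)"
        by (simp add: null_space_def Sp.diff)
      then show ?thesis using v[of n] by (simp add: algebra_simps)
    qed
    ultimately have "y \<longlonglongrightarrow> (S ^^ p) m" by (simp add: Sp.zero)
    then have "l = (S ^^ p) m" using l LIMSEQ_unique by blast
    then show "l \<in> range (S ^^ p)" by blast
  qed
qed

lemma closed_range_funpow_descend_le:
  assumes S: "bounded_clinear S" and p: "null_space (S ^^ p) = null_space (S ^^ Suc p)"
    and "p \<le> k" "closed (range (S ^^ k))"
  shows "closed (range (S ^^ p))"
  using assms(3,4)
proof (induction rule: dec_induct)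
  case (step k)
  then show ?case
    using closed_range_funpow_descend[OF S null_space_funpow_stable[OF S p]] by blast
qed

section \<open>The ascent and left Drazin invertibility\<close>

lemma ascent_eq_Least:
  assumes "null_space (S ^^ n) = null_space (S ^^ Suc n)"
  shows "ascent S = enat (LEAST n. null_space (S ^^ n) = null_space (S ^^ Suc n))"
  unfolding ascent_def
proof (rule antisym)
  show "(INF n\<in>{n. null_space (S ^^ n) = null_space (S ^^ (n + 1))}. enat n)
      \<le> enat (LEAST n. null_space (S ^^ n) = null_space (S ^^ Suc n))"
    using LeastI[of "\<lambda>n. null_space (S ^^ n) = null_space (S ^^ Suc n)", OF assms]
    by (intro INF_lower) simp
  show "enat (LEAST n. null_space (S ^^ n) = null_space (S ^^ Suc n))
      \<le> (INF n\<in>{n. null_space (S ^^ n) = null_space (S ^^ (n + 1))}. enat n)"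
    by (intro INF_greatest) (simp add: Least_le)
qed

lemma ascent_finiteE:
  assumes "ascent S < \<infinity>"
  obtains n where "null_space (S ^^ n) = null_space (S ^^ Suc n)"
proof (rule ccontr)
  assume "\<not> ?thesis"
  then have "{n. null_space (S ^^ n) = null_space (S ^^ (n + 1))} = {}"
    using that by auto
  then have "ascent S = \<infinity>" unfolding ascent_def by (simp only: image_empty Inf_enat_def) simp
  with assms show False by simp
qed

text \<open>Frees the notion from the exact ascent: any p at which the null spaces are stable
  serves, because closedness descends to the powers above the ascent.\<close>

lemma left_Drazin_invertible_iff:
  assumes S: "bounded_clinear S"
  shows "left_Drazin_invertible S \<longleftrightarrow>
    (\<exists>p. null_space (S ^^ p) = null_space (S ^^ Suc p) \<and> closed (range (S ^^ p)) \<and> closed (range (S ^^ Suc p)))"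
    (is "_ \<longleftrightarrow> (\<exists>p. ?st p \<and> ?cl p \<and> ?cl (Suc p))")
proof
  assume L: "left_Drazin_invertible S"
  then obtain n where n: "?st n" unfolding left_Drazin_invertible_def using ascent_finiteE by blast
  have "?st (LEAST n. ?st n)" using n by (rule LeastI)
  moreover have "?cl (Suc (LEAST n. ?st n))"
    using L ascent_eq_Least[OF n] unfolding left_Drazin_invertible_def by simp
  ultimately show "\<exists>p. ?st p \<and> ?cl p \<and> ?cl (Suc p)"
    using closed_range_funpow_descend[OF S] by blast
next
  assume "\<exists>p. ?st p \<and> ?cl p \<and> ?cl (Suc p)"
  then obtain p where p: "?st p" "?cl (Suc p)" by blast
  let ?a = "LEAST n. ?st n"
  have a: "?st ?a" "?a \<le> p" using p(1) by (rule LeastI, rule Least_le)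
  \<comment> \<open>The descent from \<open>Suc p\<close> has to end at \<open>Suc ?a\<close>, the
    power in the definition, so stability is needed at that exponent.\<close>
  then have "?st (Suc ?a)" by (intro null_space_funpow_stable[OF S a(1)]) simp
  then have "?cl (Suc ?a)"
    by (rule closed_range_funpow_descend_le[OF S _ _ p(2)]) (use a(2) in simp)
  then show "left_Drazin_invertible S"
    unfolding left_Drazin_invertible_def using ascent_eq_Least[OF p(1)] by simp
qed

section \<open>The index\<close>

text \<open>S maps N(S^(k+1)) in M into N(S^k) in M with kernel inside N(S), so finite dimension
  passes from k to k+1.\<close>

lemma finite_cdim_null_space_funpow_Int:
  assumes S: "bounded_clinear S" and M: "complex_vector.subspace M" "S ` M \<subseteq> M"
    and fin: "finite_cdim (null_space S \<inter> M)"
  shows "finite_cdim (null_space (S ^^ k) \<inter> M)"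
proof (induction k)
  case 0
  have "null_space (S ^^ 0) \<inter> M \<subseteq> complex_vector.span {}"
    by (auto simp: null_space_def)
  then show ?case unfolding finite_cdim_def by blast
next
  case (Suc k)
  let ?V = "null_space (S ^^ Suc k) \<inter> M"
  have V: "complex_vector.subspace ?V"
    by (intro complex_vector.subspace_inter subspace_null_space bounded_clinear_funpow S M)
  obtain B0 where B0: "finite B0" "null_space S \<inter> M \<subseteq> complex_vector.span B0"
    using fin finite_cdim_def by blast
  obtain B1 where B1: "finite B1" "null_space (S ^^ k) \<inter> M \<subseteq> complex_vector.span B1"
    using Suc.IH finite_cdim_def by blast
  have "{x \<in> ?V. S x = 0} \<subseteq> null_space S \<inter> M" by (auto simp: null_space_def)
  then have z: "{x \<in> ?V. S x = 0} \<subseteq> complex_vector.span B0" using B0(2) by (rule subset_trans)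
  have "S ` ?V \<subseteq> null_space (S ^^ k) \<inter> M"
    using M(2) by (auto simp: null_space_def funpow_swap1)
  then have i: "S ` ?V \<subseteq> complex_vector.span B1" using B1(2) by (rule subset_trans)
  show ?case
    unfolding finite_cdim_def
    by (rule complex_vector.finite_spanning_set_of_kernel_image
        [OF bounded_clinear_imp_clinear[OF S] V B0(1) z B1(1) i])
qed

lemma Fredholm_index_on_nonpos:
  assumes S: "bounded_clinear S" and M: "complex_vector.subspace M" "S ` M \<subseteq> M"
    and fin: "finite_cdim (null_space S \<inter> M)"
    and p: "null_space (S ^^ p) = null_space (S ^^ Suc p)"
  shows "Fredholm_index_on M S \<le> 0"
proof -
  \<comment> \<open>By \<open>p\<close> the exponents p and \<open>Suc p\<close> give the same
    space; the latter makes it evident that it contains N(S) in M.\<close>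
  let ?K = "null_space (S ^^ Suc p) \<inter> M"
  have K: "complex_vector.subspace ?K"
    by (intro complex_vector.subspace_inter subspace_null_space bounded_clinear_funpow S M)
  obtain F where F: "finite F" "?K \<subseteq> complex_vector.span F"
    using finite_cdim_null_space_funpow_Int[OF S M fin] finite_cdim_def by blast
  have S0: "(S ^^ p) 0 = 0"
    using bounded_clinear_funpow[OF S] bounded_clinear_imp_bounded_linear linear_simps(3) by blast
  have mem: "x \<in> null_space (S ^^ Suc n) \<longleftrightarrow> S x \<in> null_space (S ^^ n)" for x n
    by (simp add: null_space_def funpow_swap1)
  have SK: "S ` ?K \<subseteq> ?K"
  proof (rule image_subsetI)
    fix x assume x: "x \<in> ?K"
    then have "S x \<in> null_space (S ^^ p)" using mem[of x p] by simp
    moreover have "S x \<in> M" using x M(2) by auto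
    ultimately show "S x \<in> ?K" by (simp only: p[symmetric] Int_iff)
  qed
  have p': "null_space (S ^^ Suc p) = null_space (S ^^ Suc (Suc p))"
    by (rule null_space_funpow_stable[OF S p]) simp
  \<comment> \<open>This is injectivity of K / S(K) into M / S(M): a preimage in M of a vector of K
    is in N(S^(p+2)), which is N(S^(p+1)) again.\<close>
  have int: "?K \<inter> S ` M \<subseteq> S ` ?K"
  proof
    fix y assume y: "y \<in> ?K \<inter> S ` M"
    then obtain x where x: "x \<in> M" "y = S x" by blast
    then have "x \<in> null_space (S ^^ Suc p)" using y mem[of x "Suc p"] by (simp only: p'[symmetric] Int_iff)
    then show "y \<in> S ` ?K" using x by blast
  qed
  have ker: "{x \<in> ?K. S x = 0} = null_space S \<inter> M"
    using S0 by (auto simp: null_space_def funpow_swap1)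
  have "complex_vector.dim (null_space S \<inter> M) \<le> card B"
    if "finite B" "M \<subseteq> complex_vector.span (S ` M \<union> B)" for B
    using complex_vector.dim_kernel_le_card_coset_spanning
      [OF bounded_clinear_imp_clinear[OF S] K M(1) F Int_lower2 SK int that]
    unfolding ker .
  \<comment> \<open>The bound holds for every competitor B; with no competitor the infimum is
    infinite.\<close>
  then have "enat (complex_vector.dim (null_space S \<inter> M)) \<le> ccodim M (S ` M)"
    unfolding ccodim_def by (intro INF_greatest) simp
  then show ?thesis
    unfolding Fredholm_index_on_def
    by (cases "ccodim M (S ` M)") auto
qed

section \<open>The single-valued extension property\<close>

lemma vector_analytic_imp_holomorphic_cinner:
  assumes "vector_analytic_on f D"
  shows "(\<lambda>z. cinner (f z) y) holomorphic_on D"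
  unfolding holomorphic_on_def
proof
  fix z assume "z \<in> D"
  then obtain d where "(f has_derivative (\<lambda>h. h *\<^sub>C d)) (at z)"
    using assms unfolding vector_analytic_on_def by blast
  then have "((\<lambda>z. cinner (f z) y) has_derivative (\<lambda>h. cinner (h *\<^sub>C d) y)) (at z)"
    by (rule bounded_linear.has_derivative[OF bounded_linear_cinner_left])
  then have "((\<lambda>z. cinner (f z) y) has_field_derivative cinner d y) (at z)"
    unfolding has_field_derivative_def cinner_scaleC_left by (simp only: mult.commute[of _ "cinner d y"])
  then show "(\<lambda>z. cinner (f z) y) field_differentiable at z within D"
    using field_differentiable_at_within field_differentiable_def by blast
qed

text \<open>Testing f against the fixed vector f w gives a holomorphic scalar function that vanishes
  on U. Its value at w is the squared norm of f w.\<close>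

lemma vector_analytic_eq_0:
  assumes f: "vector_analytic_on f D" "open D" "connected D"
    and "U \<subseteq> D" "\<xi> \<in> D" "\<xi> islimpt U" "\<And>z. z \<in> U \<Longrightarrow> f z = 0" "w \<in> D"
  shows "f w = 0"
proof -
  have "cinner (f z) (f w) = 0" if "z \<in> U" for z
    using assms(7)[OF that] cinner_scaleC_left[of 0 0 "f w"] by simp
  then have "cinner (f w) (f w) = 0"
    using analytic_continuation[OF vector_analytic_imp_holomorphic_cinner[OF f(1)] f(2,3) assms(4-6)] assms(8)
    by blast
  then show ?thesis by (simp add: cinner_self)
qed

lemma SVEP_at_of_finite_ascent:
  assumes T: "bounded_clinear T"
    and p: "null_space (shift T \<mu> ^^ p) = null_space (shift T \<mu> ^^ Suc p)"
    and cl: "closed (range (shift T \<mu> ^^ p))" "closed (range (shift T \<mu> ^^ Suc p))"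
  shows "SVEP_at T \<mu>"
  unfolding SVEP_at_def
proof (intro allI impI ballI)
  fix r :: real and f w
  assume r: "r > 0" and f: "vector_analytic_on f (ball \<mu> r) \<and> (\<forall>\<nu>\<in>ball \<mu> r. shift T \<nu> (f \<nu>) = 0)"
    and w: "w \<in> ball \<mu> r"
  let ?S = "shift T \<mu>" let ?R = "range (?S ^^ p)"
  have S: "bounded_clinear ?S" by (rule bounded_clinear_shift[OF T])
  interpret S: bounded_linear ?S using S by (rule bounded_clinear_imp_bounded_linear)
  have R: "complex_vector.subspace ?R" by (rule subspace_range_funpow[OF S])
  have clSR: "closed (?S ` ?R)" using cl(2) by (simp only: range_funpow_Suc)
  obtain C where C: "C > 0" "\<And>y. y \<in> ?S ` ?R \<Longrightarrow> \<exists>x\<in>?R. ?S x = y \<and> norm x \<le> C * norm y"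
    using bounded_linear_open_mapping
      [OF S.bounded_linear_axioms complex_subspace_imp_subspace[OF R] cl(1) clSR] by metis
  \<comment> \<open>Injectivity of S on R(S^p) forces the bounded preimage of S x to be x
    itself.\<close>
  have below: "norm x \<le> C * norm (?S x)" if "x \<in> ?R" for x
  proof -
    have "?S x \<in> ?S ` ?R" using that by (rule imageI)
    from C(2)[OF this] obtain x' where x': "x' \<in> ?R" "?S x' = ?S x" "norm x' \<le> C * norm (?S x)"
      by blast
    have "x' - x \<in> null_space ?S \<inter> ?R"
      using x' complex_vector.subspace_diff[OF R x'(1) that] by (simp add: null_space_def S.diff)
    then have "x' = x" using null_space_Int_range_funpow[OF S p] by simp
    then show ?thesis using x' by simp
  qed
  have Sf: "?S (f \<nu>) = (\<nu> - \<mu>) *\<^sub>C f \<nu>" if "\<nu> \<in> ball \<mu> r" for \<nu>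
    using f that by (simp add: shift_def complex_vector.scale_left_diff_distrib)
  have zero: "f \<nu> = 0" if "\<nu> \<in> ball \<mu> r" "\<nu> \<noteq> \<mu>" "cmod (\<nu> - \<mu>) < 1 / C" for \<nu>
  proof -
    have "(?S ^^ k) (f \<nu>) = (\<nu> - \<mu>) ^ k *\<^sub>C f \<nu>" for k
    proof (induction k)
      case (Suc k)
      have "?S ((\<nu> - \<mu>) ^ k *\<^sub>C f \<nu>) = (\<nu> - \<mu>) ^ k *\<^sub>C ?S (f \<nu>)"
        using S unfolding bounded_clinear_def by blast
      then show ?case using Suc by (simp add: Sf[OF that(1)] scaleC_scaleC mult.commute)
    qed (simp add: scaleC_one)
    \<comment> \<open>As an eigenvector for a nonzero eigenvalue, f \<nu> lies in R(S^p). There the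
      lower bound excludes nonzero eigenvectors with eigenvalue below 1/C in modulus.\<close>
    then have "f \<nu> = inverse ((\<nu> - \<mu>) ^ p) *\<^sub>C (?S ^^ p) (f \<nu>)"
      using that(2) by (simp add: scaleC_scaleC scaleC_one)
    moreover have "inverse ((\<nu> - \<mu>) ^ p) *\<^sub>C (?S ^^ p) (f \<nu>) \<in> ?R"
      by (intro complex_vector.subspace_scale R rangeI)
    ultimately have "f \<nu> \<in> ?R" by simp
    then have le: "norm (f \<nu>) \<le> C * cmod (\<nu> - \<mu>) * norm (f \<nu>)"
      using below[of "f \<nu>"] by (simp add: Sf[OF that(1)] norm_scaleC mult.assoc)
    have "C * cmod (\<nu> - \<mu>) < 1" using that(3) C(1) by (simp add: pos_less_divide_eq mult.commute)
    then have "C * cmod (\<nu> - \<mu>) * norm (f \<nu>) < 1 * norm (f \<nu>)" if "norm (f \<nu>) > 0"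
      using that by (rule mult_strict_right_mono)
    with le have "\<not> norm (f \<nu>) > 0" by linarith
    then show ?thesis by simp
  qed
  \<comment> \<open>The centre is left out because of the division by (\<nu> - \<mu>)^p; it is still
    a limit point, so the identity theorem covers it.\<close>
  let ?U = "ball \<mu> (min r (1 / C)) - {\<mu>}"
  have "min r (1 / C) > 0" using r C(1) by simp
  then have "\<mu> islimpt ball \<mu> (min r (1 / C))"
    using islimpt_ball[of \<mu> \<mu> "min r (1 / C)"] by simp
  then have lim: "\<mu> islimpt ?U" unfolding islimpt_def by blast
  have zeroU: "f z = 0" if "z \<in> ?U" for z
  proof (rule zero)
    show "z \<in> ball \<mu> r" "z \<noteq> \<mu>" using that by simp_all
    have "dist \<mu> z < 1 / C" using that by simp
    then show "cmod (z - \<mu>) < 1 / C" by (simp add: dist_norm norm_minus_commute)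
  qed
  have sub: "?U \<subseteq> ball \<mu> r" by auto
  have mem: "\<mu> \<in> ball \<mu> r" using r by simp
  show "f w = 0"
    by (rule vector_analytic_eq_0[OF conjunct1[OF f] open_ball connected_ball sub mem lim zeroU w])
qed

section \<open>Vector power series and eigenvector families\<close>

lemma summable_Suc_power:
  fixes a :: real assumes "norm a < 1"
  shows "summable (\<lambda>n. real n * a ^ (n - 1))"
proof -
  have "summable (\<lambda>n. real (Suc n) * a ^ n)"
    using geometric_deriv_sums[of a] assms by (simp add: sums_iff)
  then show ?thesis by (subst summable_Suc_iff[symmetric]) simp
qed

text \<open>On the disc of half the guaranteed radius 1/C the differentiated terms are dominated by
  multiples of n (1/2)^(n-1). Hence the series of derivatives converges uniformly and may be
  integrated back to the derivative of the sum.\<close>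

lemma vector_power_series_analytic:
  fixes x :: "nat \<Rightarrow> 'a :: complex_hilbert_space"
  assumes C: "C > 0" and x: "\<And>n. norm (x n) \<le> A * C ^ n"
  obtains f where "vector_analytic_on f (ball \<mu> (1 / (2 * C)))"
    "\<And>z. z \<in> ball \<mu> (1 / (2 * C)) \<Longrightarrow> (\<lambda>n. (z - \<mu>) ^ n *\<^sub>C x n) sums f z"
proof -
  let ?D = "ball \<mu> (1 / (2 * C))"
  \<comment> \<open>For n = 0 the truncated exponent n - 1 is harmless, as the factor n is
    0.\<close>
  let ?c = "\<lambda>n z. (of_nat n * (z - \<mu>) ^ (n - 1)) *\<^sub>C x n"
  define g where "g z = (\<Sum>n. ?c n z)" for z
  have bound: "norm (?c n z) \<le> A * C * (real n * (1 / 2) ^ (n - 1))" if "z \<in> ?D" for n z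
  proof (cases n)
    case (Suc m)
    have "cmod (z - \<mu>) \<le> 1 / (2 * C)" using that by (simp add: dist_norm norm_minus_commute)
    then have "cmod (z - \<mu>) ^ m \<le> (1 / (2 * C)) ^ m" by (intro power_mono) auto
    then have "cmod (z - \<mu>) ^ m * norm (x n) \<le> (1 / (2 * C)) ^ m * (A * C ^ n)"
      using x[of n] C by (intro mult_mono) auto
    also have "\<dots> = A * C * (1 / 2) ^ m"
      using C Suc by (simp add: power_divide power_mult_distrib field_simps)
    finally have "real n * (cmod (z - \<mu>) ^ m * norm (x n)) \<le> real n * (A * C * (1 / 2) ^ m)"
      by (intro mult_left_mono) auto
    moreover have "norm (?c n z) = real n * (cmod (z - \<mu>) ^ m * norm (x n))"
      by (simp only: norm_scaleC norm_mult norm_of_nat norm_power mult.assoc Suc diff_Suc_1)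
    ultimately show ?thesis using Suc by (simp add: mult_ac del: of_nat_Suc)
  qed simp
  have sm: "summable (\<lambda>n. A * C * (real n * (1 / 2) ^ (n - 1)))"
    by (intro summable_mult summable_Suc_power) simp
  have unif: "uniform_limit ?D (\<lambda>n z. \<Sum>i<n. ?c i z) g sequentially"
    unfolding g_def by (rule Weierstrass_m_test[OF bound sm])
  have "\<exists>f. \<forall>z\<in>?D. (\<lambda>n. (z - \<mu>) ^ n *\<^sub>C x n) sums f z \<and> (f has_derivative (\<lambda>h. h *\<^sub>C g z)) (at z within ?D)"
  proof (rule has_derivative_series)
    show "((\<lambda>z. (z - \<mu>) ^ n *\<^sub>C x n) has_derivative (\<lambda>h. h *\<^sub>C ?c n z)) (at z within ?D)" for n z
    proof -
      have "((\<lambda>z. (z - \<mu>) ^ n) has_derivative (\<lambda>h. of_nat n * (z - \<mu>) ^ (n - 1) * h)) (at z within ?D)"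
        by (rule has_derivative_eq_rhs, (rule derivative_intros)+) (auto simp: fun_eq_iff mult_ac)
      then have "((\<lambda>z. (z - \<mu>) ^ n *\<^sub>C x n) has_derivative (\<lambda>h. (of_nat n * (z - \<mu>) ^ (n - 1) * h) *\<^sub>C x n)) (at z within ?D)"
        by (rule bounded_linear.has_derivative[OF bounded_bilinear.bounded_linear_left[OF bounded_bilinear_scaleC]])
      then show ?thesis by (simp add: scaleC_scaleC mult_ac)
    qed
    show "\<forall>\<^sub>F n in sequentially. \<forall>z\<in>?D. \<forall>h. norm ((\<Sum>i<n. h *\<^sub>C ?c i z) - h *\<^sub>C g z) \<le> e * norm h" if "e > 0" for e
      using uniform_limitD[OF unif that]
    proof eventually_elim
      case (elim n)
      show ?case
      proof (intro ballI allI)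
        fix z h assume "z \<in> ?D"
        with elim have "dist (\<Sum>i<n. ?c i z) (g z) < e" by (rule bspec)
        then have "norm ((\<Sum>i<n. ?c i z) - g z) \<le> e" unfolding dist_norm by (rule less_imp_le)
        then have "norm (h *\<^sub>C ((\<Sum>i<n. ?c i z) - g z)) \<le> e * norm h"
          unfolding norm_scaleC by (subst mult.commute) (rule mult_right_mono, auto)
        then show "norm ((\<Sum>i<n. h *\<^sub>C ?c i z) - h *\<^sub>C g z) \<le> e * norm h"
          by (simp only: complex_vector.scale_right_diff_distrib complex_vector.scale_sum_right)
      qed
    qed
    \<comment> \<open>Termwise differentiation needs convergence at one point; at the centre only
      the constant term survives.\<close>
    show "(\<lambda>n. (\<mu> - \<mu>) ^ n *\<^sub>C x n) sums x 0"
      using sums_finite[of "{0}" "\<lambda>n. (\<mu> - \<mu>) ^ n *\<^sub>C x n"] by (simp add: scaleC_one)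
  qed (use C in auto)
  then obtain f where f: "\<And>z. z \<in> ?D \<Longrightarrow> (\<lambda>n. (z - \<mu>) ^ n *\<^sub>C x n) sums f z"
    "\<And>z. z \<in> ?D \<Longrightarrow> (f has_derivative (\<lambda>h. h *\<^sub>C g z)) (at z within ?D)" by blast
  have "vector_analytic_on f ?D"
    unfolding vector_analytic_on_def using f(2) at_within_open[OF _ open_ball] by metis
  with f(1) that show ?thesis by blast
qed

text \<open>Iterating bounded preimages \<open>x\<^sub>n\<^sub>+\<^sub>1\<close> of \<open>x\<^sub>n\<close>, starting from the kernel vector
  \<open>x\<^sub>0\<close>, the power series with coefficients \<open>x\<^sub>n\<close> is an analytic family of eigenvectors.\<close>
lemma not_SVEP_at_of_surjective_part:
  assumes T: "bounded_clinear T" and W: "complex_vector.subspace W" "closed W" "shift T \<mu> ` W = W"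
    and x0: "x\<^sub>0 \<in> W" "x\<^sub>0 \<noteq> 0" "shift T \<mu> x\<^sub>0 = 0"
  shows "\<not> SVEP_at T \<mu>"
proof
  assume SVEP: "SVEP_at T \<mu>"
  let ?S = "shift T \<mu>"
  have S: "bounded_clinear ?S" by (rule bounded_clinear_shift[OF T])
  interpret S: bounded_linear ?S using S by (rule bounded_clinear_imp_bounded_linear)
  have clW: "closed (?S ` W)" by (simp only: W)
  obtain C where C: "C > 0" "\<And>y. y \<in> ?S ` W \<Longrightarrow> \<exists>x\<in>W. ?S x = y \<and> norm x \<le> C * norm y"
    using bounded_linear_open_mapping
      [OF S.bounded_linear_axioms complex_subspace_imp_subspace[OF W(1)] W(2) clW] by metis
  have "\<forall>y. \<exists>x. y \<in> W \<longrightarrow> x \<in> W \<and> ?S x = y \<and> norm x \<le> C * norm y"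
    using C(2) unfolding W(3) by blast
  then obtain g where g: "\<And>y. y \<in> W \<Longrightarrow> g y \<in> W \<and> ?S (g y) = y \<and> norm (g y) \<le> C * norm y"
    by metis
  define x where "x n = (g ^^ n) x\<^sub>0" for n
  have xW: "x n \<in> W" for n by (induction n) (auto simp: x_def x0 g)
  have Sx: "?S (x (Suc n)) = x n" for n using g[OF xW[of n]] by (simp add: x_def)
  have x_le: "norm (x n) \<le> norm x\<^sub>0 * C ^ n" for n
  proof (induction n)
    case (Suc n)
    have "norm (x (Suc n)) \<le> C * norm (x n)" using g[OF xW[of n]] by (simp add: x_def)
    also have "\<dots> \<le> C * (norm x\<^sub>0 * C ^ n)" using Suc C(1) by (intro mult_left_mono) auto
    finally show ?case by (simp add: mult_ac)
  qed (simp add: x_def)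
  let ?D = "ball \<mu> (1 / (2 * C))"
  obtain f where f: "vector_analytic_on f ?D" "\<And>z. z \<in> ?D \<Longrightarrow> (\<lambda>n. (z - \<mu>) ^ n *\<^sub>C x n) sums f z"
    using vector_power_series_analytic[OF C(1) x_le] by metis
  have eig: "shift T \<nu> (f \<nu>) = 0" if "\<nu> \<in> ?D" for \<nu>
  proof -
    let ?t = "\<lambda>n. (\<nu> - \<mu>) ^ n *\<^sub>C x n"
    have scale: "?S (c *\<^sub>C v) = c *\<^sub>C ?S v" for c v
      using S unfolding bounded_clinear_def by blast
    \<comment> \<open>S lowers the index of x by one, so multiplying the series by \<nu> - \<mu>
      gives S applied to its tail; the omitted first term is in the kernel.\<close>
    have "(\<lambda>n. (\<nu> - \<mu>) *\<^sub>C ?t n) sums ((\<nu> - \<mu>) *\<^sub>C f \<nu>)"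
      by (rule bounded_linear.sums[OF bounded_bilinear.bounded_linear_right[OF bounded_bilinear_scaleC] f(2)[OF that]])
    moreover have "(\<lambda>n. (\<nu> - \<mu>) *\<^sub>C ?t n) = (\<lambda>n. ?S (?t (Suc n)))"
      by (simp add: scale Sx scaleC_scaleC)
    ultimately have "(\<lambda>n. ?S (?t (Suc n))) sums ((\<nu> - \<mu>) *\<^sub>C f \<nu>)" by simp
    then have "(\<lambda>n. ?S (?t n)) sums ((\<nu> - \<mu>) *\<^sub>C f \<nu> + ?S (?t 0))"
      by (rule sums_Suc)
    moreover have "?S (?t 0) = 0" by (simp add: x_def x0 scaleC_one)
    ultimately have "(\<lambda>n. ?S (?t n)) sums ((\<nu> - \<mu>) *\<^sub>C f \<nu>)" by simp
    moreover have "(\<lambda>n. ?S (?t n)) sums ?S (f \<nu>)" by (rule S.sums[OF f(2)[OF that]])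
    ultimately have "?S (f \<nu>) = (\<nu> - \<mu>) *\<^sub>C f \<nu>" using sums_unique2 by metis
    then show ?thesis by (simp add: shift_def complex_vector.scale_left_diff_distrib)
  qed
  have \<mu>: "\<mu> \<in> ?D" using C(1) by simp
  have "f \<mu> = 0"
    using SVEP[unfolded SVEP_at_def, rule_format, of "1 / (2 * C)" f \<mu>] C(1) f(1) eig \<mu> by simp
  moreover have "(\<lambda>n. (\<mu> - \<mu>) ^ n *\<^sub>C x n) sums x 0"
    using sums_finite[of "{0}" "\<lambda>n. (\<mu> - \<mu>) ^ n *\<^sub>C x n"] by (simp add: scaleC_one)
  ultimately have "x 0 = 0" using f(2)[OF \<mu>] sums_unique2 by metis
  then show False using x0 by (simp add: x_def)
qed

text \<open>Stabilisation of the finite-dimensional N(S) in R(S^k) is what makes S map the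
  intersection of the ranges onto itself. The extension property then forces the stable kernel to be
  0.\<close>

lemma SVEP_at_imp_finite_ascent:
  assumes T: "bounded_clinear T" and SVEP: "SVEP_at T \<mu>"
    and cl: "\<And>k. k \<ge> n \<Longrightarrow> closed (range (shift T \<mu> ^^ k))"
    and fin: "finite_cdim (null_space (shift T \<mu>) \<inter> range (shift T \<mu> ^^ n))"
  shows "\<exists>p. null_space (shift T \<mu> ^^ p) = null_space (shift T \<mu> ^^ Suc p)"
proof -
  let ?S = "shift T \<mu>" let ?R = "\<lambda>k. range (?S ^^ k)"
  have S: "bounded_clinear ?S" by (rule bounded_clinear_shift[OF T])
  interpret S: bounded_linear ?S using S by (rule bounded_clinear_imp_bounded_linear)
  define N where "N k = null_space ?S \<inter> ?R k" for k
  have subN: "complex_vector.subspace (N k)" for k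
    unfolding N_def by (intro complex_vector.subspace_inter subspace_null_space subspace_range_funpow S)
  have N_anti: "N k \<subseteq> N j" if "j \<le> k" for j k
    unfolding N_def using range_funpow_antimono[OF that, of ?S] by (rule Int_mono[OF order_refl])
  obtain F where F: "finite F" "N n \<subseteq> complex_vector.span F"
    using fin unfolding N_def finite_cdim_def by blast
  define d where "d k = complex_vector.dim (N (n + k))" for k
  \<comment> \<open>These spaces decrease with k, so from the index of least dimension on they are
    constant.\<close>
  obtain j where j: "\<And>i. d j \<le> d i"
    using ex_has_least_nat[of "\<lambda>_. True" 0 d] by auto
  let ?K = "n + j"
  have N_stable: "N k = N ?K" if "k \<ge> ?K" for k
  proof (rule complex_vector.subspace_eq_of_dim_ge[OF subN N_anti[OF that] F(1)])
    show "N ?K \<subseteq> complex_vector.span F" using N_anti[of n ?K] F(2) by simp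
    show "complex_vector.dim (N ?K) \<le> complex_vector.dim (N k)"
      using j[of "k - n"] that by (simp add: d_def)
  qed
  \<comment> \<open>Starting at \<open>?K\<close> keeps all the ranges closed; as ranges decrease,
    this is the intersection of all of them.\<close>
  define W where "W = (\<Inter>k\<in>{?K..}. ?R k)"
  have WD: "x \<in> ?R k" if "x \<in> W" for x k
  proof -
    have "x \<in> ?R (max k ?K)" using that by (simp add: W_def)
    then show ?thesis using range_funpow_antimono[of k "max k ?K" ?S] by auto
  qed
  have W: "complex_vector.subspace W" "closed W"
    unfolding W_def
    by (auto intro!: complex_vector.subspace_Inter closed_INT subspace_range_funpow S cl)
  have NW: "N ?K \<subseteq> W"
  proof
    fix x assume "x \<in> N ?K"
    then have "x \<in> N k" if "k \<ge> ?K" for k using N_stable[OF that] by simp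
    then show "x \<in> W" by (auto simp: W_def N_def)
  qed
  have SW: "?S ` W = W"
  proof
    show "?S ` W \<subseteq> W"
    proof (rule image_subsetI)
      fix x assume x: "x \<in> W"
      have "?S x \<in> ?R k" for k
        using range_funpow_antimono[of k "Suc k" ?S] imageI[OF WD[OF x, of k], of ?S]
        by (simp only: range_funpow_Suc) auto
      then show "?S x \<in> W" by (simp add: W_def)
    qed
    show "W \<subseteq> ?S ` W"
    proof
      fix y assume y: "y \<in> W"
      have "\<exists>w\<in>?R k. y = ?S w" for k
        using WD[OF y, of "Suc k"] unfolding range_funpow_Suc by auto
      then obtain w where w: "\<And>k. w k \<in> ?R k" "\<And>k. y = ?S (w k)" by metis
      \<comment> \<open>Preimages of y chosen in different ranges differ by an element of N ?K,
        which lies in every range; so one preimage serves for all k.\<close>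
      have "w ?K \<in> ?R k" if k: "k \<ge> ?K" for k
      proof -
        have wk: "w k \<in> ?R ?K" using w(1)[of k] range_funpow_antimono[OF k, of ?S] by (rule rev_subsetD)
        have "?S (w ?K - w k) = 0" unfolding S.diff w(2)[symmetric] by simp
        moreover have "w ?K - w k \<in> ?R ?K"
          by (rule complex_vector.subspace_diff[OF subspace_range_funpow[OF S] w(1) wk])
        ultimately have "w ?K - w k \<in> N ?K" by (simp add: N_def null_space_def)
        then have "w ?K - w k \<in> ?R k" using WD NW by blast
        then have "(w ?K - w k) + w k \<in> ?R k"
          by (rule complex_vector.subspace_add[OF subspace_range_funpow[OF S] _ w(1)])
        then show ?thesis by simp
      qed
      then have "w ?K \<in> W" by (simp add: W_def)
      then show "y \<in> ?S ` W" using w(2) by blast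
    qed
  qed
  have N0: "x = 0" if "x \<in> N ?K" for x
  proof (rule ccontr)
    assume x: "x \<noteq> 0"
    have "?S x = 0" using that by (simp add: N_def null_space_def)
    with not_SVEP_at_of_surjective_part[OF T W SW subsetD[OF NW that] x] SVEP
    show False by blast
  qed
  have "null_space (?S ^^ ?K) = null_space (?S ^^ Suc ?K)"
  proof
    show "null_space (?S ^^ ?K) \<subseteq> null_space (?S ^^ Suc ?K)"
      by (auto simp: null_space_def S.zero)
    show "null_space (?S ^^ Suc ?K) \<subseteq> null_space (?S ^^ ?K)"
    proof
      fix x assume "x \<in> null_space (?S ^^ Suc ?K)"
      then have "(?S ^^ ?K) x \<in> N ?K" by (simp add: null_space_def N_def)
      then show "x \<in> null_space (?S ^^ ?K)" using N0 by (simp add: null_space_def)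
    qed
  qed
  then show ?thesis by blast
qed

section \<open>Upper semi-B-Fredholm operators and the pointwise equivalence\<close>

lemma upper_semi_B_Fredholm_at_iff:
  "upper_semi_B_Fredholm_at S n \<longleftrightarrow>
    closed (range (S ^^ n)) \<and> closed (range (S ^^ Suc n)) \<and> finite_cdim (null_space S \<inter> range (S ^^ n))"
proof -
  have "range (S ^^ Suc n) \<subseteq> range (S ^^ n)" by (rule range_funpow_antimono) simp
  then have "closedin (top_of_set (range (S ^^ n))) (range (S ^^ Suc n)) \<longleftrightarrow> closed (range (S ^^ Suc n))"
    if "closed (range (S ^^ n))"
    using that closedin_closed_eq by blast
  then show ?thesis
    unfolding upper_semi_B_Fredholm_at_def upper_semi_Fredholm_on_def range_funpow_Suc by blast
qed

text \<open>Each later range is a closed subspace of R(S^n), on which S is upper semi-Fredholm, so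
  its image is closed as well.\<close>

lemma closed_range_funpow_of_upper_semi_B_Fredholm:
  assumes S: "bounded_clinear S" and n: "upper_semi_B_Fredholm_at S n" and "n \<le> k"
  shows "closed (range (S ^^ k))"
  using assms(3)
proof (induction rule: dec_induct)
  case base
  then show ?case using n upper_semi_B_Fredholm_at_iff by blast
next
  case (step k)
  have "closed (S ` range (S ^^ k))"
  proof (rule closed_image_closed_subspace[OF S subspace_range_funpow[OF S, of n]])
    show "closed (range (S ^^ n))" "closed (S ` range (S ^^ n))"
      "finite_cdim (null_space S \<inter> range (S ^^ n))"
      using n by (simp_all only: upper_semi_B_Fredholm_at_iff range_funpow_Suc)
    show "range (S ^^ k) \<subseteq> range (S ^^ n)" by (rule range_funpow_antimono[OF step.hyps(1)])
  qed (rule subspace_range_funpow[OF S], rule step.IH)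
  then show ?case by (simp only: range_funpow_Suc)
qed

lemma left_Drazin_invertible_shift_iff:
  assumes T: "bounded_clinear T"
  shows "left_Drazin_invertible (shift T \<mu>) \<longleftrightarrow> shift T \<mu> \<in> SBF_plus_minus \<and> SVEP_at T \<mu>"
proof
  let ?S = "shift T \<mu>"
  have S: "bounded_clinear ?S" by (rule bounded_clinear_shift[OF T])
  assume "left_Drazin_invertible ?S"
  then obtain p where p: "null_space (?S ^^ p) = null_space (?S ^^ Suc p)"
      "closed (range (?S ^^ p))" "closed (range (?S ^^ Suc p))"
    using left_Drazin_invertible_iff[OF S] by blast
  have "finite_cdim (null_space ?S \<inter> range (?S ^^ p))"
    unfolding null_space_Int_range_funpow[OF S p(1)] finite_cdim_def
    by (rule exI[of _ "{0}"]) (simp add: complex_vector.span_base)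
  with p have "upper_semi_B_Fredholm_at ?S p" by (simp only: upper_semi_B_Fredholm_at_iff)
  moreover define n where "n = (LEAST n. upper_semi_B_Fredholm_at ?S n)"
  ultimately have n: "upper_semi_B_Fredholm_at ?S n" by (metis LeastI)
  \<comment> \<open>The index is taken at the least admissible n, possibly below p, where the null
    space may be nontrivial; hence the general estimate.\<close>
  have "B_Fredholm_index ?S \<le> 0"
    unfolding B_Fredholm_index_def n_def[symmetric]
  proof (rule Fredholm_index_on_nonpos[OF S subspace_range_funpow[OF S] _ _ p(1)])
    show "?S ` range (?S ^^ n) \<subseteq> range (?S ^^ n)"
      unfolding range_funpow_Suc[symmetric] by (rule range_funpow_antimono) simp
    show "finite_cdim (null_space ?S \<inter> range (?S ^^ n))"
      using n upper_semi_B_Fredholm_at_iff by blast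
  qed
  then show "?S \<in> SBF_plus_minus \<and> SVEP_at T \<mu>"
    using S n SVEP_at_of_finite_ascent[OF T p] unfolding SBF_plus_minus_def upper_semi_B_Fredholm_def
    by blast
next
  let ?S = "shift T \<mu>"
  have S: "bounded_clinear ?S" by (rule bounded_clinear_shift[OF T])
  assume R: "?S \<in> SBF_plus_minus \<and> SVEP_at T \<mu>"
  then obtain n where n: "upper_semi_B_Fredholm_at ?S n"
    unfolding SBF_plus_minus_def upper_semi_B_Fredholm_def by blast
  have cl: "closed (range (?S ^^ k))" if "k \<ge> n" for k
    by (rule closed_range_funpow_of_upper_semi_B_Fredholm[OF S n that])
  have "finite_cdim (null_space ?S \<inter> range (?S ^^ n))"
    using n upper_semi_B_Fredholm_at_iff by blast
  then obtain p where p: "null_space (?S ^^ p) = null_space (?S ^^ Suc p)"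
    using SVEP_at_imp_finite_ascent[OF T _ cl] R by blast
  \<comment> \<open>Stability holds from p on and closedness from n on; the maximum has
    both.\<close>
  then have "null_space (?S ^^ max p n) = null_space (?S ^^ Suc (max p n))"
    by (rule null_space_funpow_stable[OF S]) simp
  moreover have "closed (range (?S ^^ max p n))" by (rule cl) simp
  moreover have "closed (range (?S ^^ Suc (max p n)))" by (rule cl) simp
  ultimately show "left_Drazin_invertible ?S"
    using left_Drazin_invertible_iff[OF S] by blast
qed

theorem theorem2p3:
  fixes T :: "'a :: complex_hilbert_space \<Rightarrow> 'a"
  assumes "bounded_clinear T"
  shows "SBF_plus_minus_spectrum T \<union> SVEP_failure_set T = left_Drazin_spectrum T"
  using left_Drazin_invertible_shift_iff[OF assms]
  unfolding SBF_plus_minus_spectrum_def SVEP_failure_set_def left_Drazin_spectrum_def by auto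

end
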